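(* There exists an algorithm that, given $g\in\Gamma$ represented by a word $w$ in the generators $X=\{x_1,\dots,x_n\}$ and given $D\in\mathrm{Div}\,\mathcal H_p$, computes divisors $D_1,\dots,D_n\in\mathrm{Div}\,\mathcal H_p$ such that \[ g\otimes D\equiv \sum_{i=1}^n x_i\otimes D_i \pmod{B_1(\Gamma,\mathrm{Div}\,\mathcal H_p)}, \qquad \deg(D_i) = v_{x_i}(w)\deg(D)\ \text{ for all } i. \]
   Context: Let $p$ be a prime, $D_B>1$ a product of an even number of distinct primes and $M\ge1$ with $\gcd(D_B,M)=1$, $p\nmid D_BM$. Let $B$ be the quaternion algebra over $\mathbb{Q}$ of discriminant $D_B$, $R_0(M)\subset B$ an Eichler order of level $M$, $R=R_0(M)\otimes\mathbb{Z}[1/p]$ and $\Gamma$ its group of reduced-norm-$1$ elements. Fix $\iota_p:B\otimes\mathbb{Q}_p\cong M_2(\mathbb{Q}_p)$. Let $K$ be a real quadratic field in which $p$ is inert, $K_p$ its completion at $p$, and $\mathcal H_p=K_p\setminus\mathbb{Q}_p$, on which $\Gamma$ acts by Möbius transformations through $\iota_p$; let $\mathrm{Div}\,\mathcal H_p$ be the free abelian group on $\mathcal H_p$ with the induced $\Gamma$-action and degree map $\deg$. Let $C_1=\mathbb{Z}[\Gamma]\otimes\mathrm{Div}\,\mathcal H_p$, $C_2=\mathbb{Z}[\Gamma]\otimes\mathbb{Z}[\Gamma]\otimes\mathrm{Div}\,\mathcal H_p$ with $\partial_2(g\otimes h\otimes D)=h\otimes g^{-1}D-gh\otimes D+g\otimes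 D$, and $B_1(\Gamma,\mathrm{Div}\,\mathcal H_p)=\partial_2(C_2)$. Let $\langle X\mid R\rangle$, $X=\{x_1,\dots,x_n\}$, be a finite presentation of $\Gamma$ (which is computable). For a word $w$ in $X^{\pm1}$ and $x\in X$, let $v_x(w)\in\mathbb{Z}$ be the sum of the exponents of $x$ occurring in $w$. (Here $D_B$ denotes the discriminant, to avoid a clash with the divisor $D$.) *)

theory Defs
  imports
    "HOL-Analysis.Analysis"
    "HOL-Algebra.Group"
    "HOL-Library.Poly_Mapping"
    "HOL-Computational_Algebra.Squarefree"
begin

unbundle no fps_syntax

section \<open>Valuations, the real quadratic field and its completion\<close>

text \<open>
  \<open>padic_abs \<O> p\<close> is the absolute value of the prime ideal \<open>p\<O>\<close> of a Dedekind domain \<open>\<O>\<close>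
  (given as a subset of a field containing its fraction field), normalised by \<open>|p| = 1/p\<close>:
  the order of \<open>x\<close> is the largest \<open>n\<close> with \<open>x/p^n\<close> in the localisation of \<open>\<O>\<close> at \<open>p\<O>\<close>,
  i.e. \<open>s x/p^n \<in> \<O>\<close> for some \<open>s \<in> \<O> - p\<O>\<close>. It is used for \<open>\<O> = \<int>\<close> and for the ring of integers
  of a quadratic field in which \<open>p\<close> is inert.
\<close>

definition padic_ord :: "'a::field set \<Rightarrow> nat \<Rightarrow> 'a \<Rightarrow> int" where
  "padic_ord \<O> p x =
     (GREATEST n. \<exists>s\<in>\<O>. s / of_nat p \<notin> \<O> \<and> s * x / (of_nat p powi n) \<in> \<O>)"

definition padic_abs :: "'a::field set \<Rightarrow> nat \<Rightarrow> 'a \<Rightarrow> real" where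
  "padic_abs \<O> p x = (if x = 0 then 0 else real p powi (- padic_ord \<O> p x))"

definition real_quadratic_field :: "real set \<Rightarrow> bool" where
  "real_quadratic_field K \<longleftrightarrow>
     (\<exists>d::nat. d > 1 \<and> squarefree d \<and> K = {of_rat r + of_rat s * sqrt (real d) | r s. True})"

definition ring_of_integers :: "real set \<Rightarrow> real set" where
  "ring_of_integers K = {x \<in> K. algebraic_int x}"

definition inert :: "nat \<Rightarrow> real set \<Rightarrow> bool" where
  "inert p K \<longleftrightarrow>
     (let \<O> = ring_of_integers K; P = {real p * y | y. y \<in> \<O>}
      in 1 \<notin> P \<and> (\<forall>x\<in>\<O>. \<forall>y\<in>\<O>. x * y \<in> P \<longrightarrow> x \<in> P \<or> y \<in> P))"

definition abs_dist :: "('k::field \<Rightarrow> real) \<Rightarrow> 'k \<Rightarrow> 'k \<Rightarrow> real" where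
  "abs_dist nrm x y = nrm (x - y)"

text \<open>
  The field \<open>'k\<close> with absolute value \<open>nrm\<close> and embedding \<open>\<sigma> : K \<rightarrow> 'k\<close> is the completion of \<open>K\<close>
  at the prime ideal generated by \<open>p\<close>. This determines \<open>('k, nrm, \<sigma>)\<close> up to unique isomorphism.
  Values of \<open>\<sigma>\<close> outside \<open>K\<close> are irrelevant.
\<close>

definition completion_at ::
  "real set \<Rightarrow> nat \<Rightarrow> ('k::field_char_0 \<Rightarrow> real) \<Rightarrow> (real \<Rightarrow> 'k) \<Rightarrow> bool" where
  "completion_at K p nrm \<sigma> \<longleftrightarrow>
     (\<forall>x. nrm x \<ge> 0) \<and> (\<forall>x. nrm x = 0 \<longleftrightarrow> x = 0) \<and>
     (\<forall>x y. nrm (x * y) = nrm x * nrm y) \<and> (\<forall>x y. nrm (x + y) \<le> max (nrm x) (nrm y)) \<and>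
     Metric_space.mcomplete UNIV (abs_dist nrm) \<and>
     \<sigma> 1 = 1 \<and> (\<forall>x\<in>K. \<forall>y\<in>K. \<sigma> (x + y) = \<sigma> x + \<sigma> y \<and> \<sigma> (x * y) = \<sigma> x * \<sigma> y) \<and>
     (\<forall>x\<in>K. nrm (\<sigma> x) = padic_abs (ring_of_integers K) p x) \<and>
     Abstract_Topology.closure_of (Metric_space.mtopology UNIV (abs_dist nrm)) (\<sigma> ` K) = UNIV"

text \<open>The completion \<open>\<rat>\<^sub>p\<close> of \<open>\<rat>\<close> is realised inside \<open>K\<^sub>p\<close> as the closure of \<open>\<rat>\<close>.\<close>

definition Qp :: "('k::field_char_0 \<Rightarrow> real) \<Rightarrow> 'k set" where
  "Qp nrm = Abstract_Topology.closure_of (Metric_space.mtopology UNIV (abs_dist nrm)) \<rat>"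

definition Hp :: "('k::field_char_0 \<Rightarrow> real) \<Rightarrow> 'k set" where
  "Hp nrm = UNIV - Qp nrm"

section \<open>Quaternion algebras\<close>

text \<open>
  The quaternion algebra \<open>(a, b | F)\<close> with basis \<open>1, i, j, ij\<close>, where \<open>i\<^sup>2 = a\<close>, \<open>j\<^sup>2 = b\<close> and
  \<open>ji = - ij\<close>, is \<open>F^4\<close> with the following multiplication. Base change to an extension field only
  changes the coordinates.
\<close>

definition qmul :: "'f::field \<Rightarrow> 'f \<Rightarrow> 'f^4 \<Rightarrow> 'f^4 \<Rightarrow> 'f^4" where
  "qmul a b x y = vector
     [x$1 * y$1 + a * x$2 * y$2 + b * x$3 * y$3 - a * b * x$4 * y$4,
      x$1 * y$2 + x$2 * y$1 - b * x$3 * y$4 + b * x$4 * y$3,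
      x$1 * y$3 + x$3 * y$1 + a * x$2 * y$4 - a * x$4 * y$2,
      x$1 * y$4 + x$4 * y$1 + x$2 * y$3 - x$3 * y$2]"

definition qone :: "'f::field^4" where
  "qone = vector [1, 0, 0, 0]"

definition reduced_norm :: "'f::field \<Rightarrow> 'f \<Rightarrow> 'f^4 \<Rightarrow> 'f" where
  "reduced_norm a b x = (x$1)^2 - a * (x$2)^2 - b * (x$3)^2 + a * b * (x$4)^2"

text \<open>
  With \<open>\<rat>\<^sub>l\<close> realised as \<open>l\<close>-adic Cauchy sequences modulo null sequences, an element of
  \<open>B \<otimes> \<rat>\<^sub>l\<close> is a coordinatewise Cauchy sequence in \<open>B\<close> modulo coordinatewise null sequences.
  The prime \<open>l\<close> is ramified if \<open>B \<otimes> \<rat>\<^sub>l\<close> is a division algebra.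
\<close>

definition local_cauchy :: "nat \<Rightarrow> (nat \<Rightarrow> rat^4) \<Rightarrow> bool" where
  "local_cauchy l X \<longleftrightarrow>
     (\<forall>i. Metric_space.MCauchy UNIV (\<lambda>u v. padic_abs \<int> l (u - v)) (\<lambda>n. X n $ i))"

definition local_null :: "nat \<Rightarrow> (nat \<Rightarrow> rat^4) \<Rightarrow> bool" where
  "local_null l X \<longleftrightarrow> (\<forall>i. (\<lambda>n. padic_abs \<int> l (X n $ i)) \<longlonglongrightarrow> 0)"

definition ramified :: "rat \<Rightarrow> rat \<Rightarrow> nat \<Rightarrow> bool" where
  "ramified a b l \<longleftrightarrow>
     (\<forall>X. local_cauchy l X \<and> \<not> local_null l X \<longrightarrow>
        (\<exists>Y. local_cauchy l Y \<and> local_null l (\<lambda>n. qmul a b (X n) (Y n) - qone)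
                              \<and> local_null l (\<lambda>n. qmul a b (Y n) (X n) - qone)))"

definition quat_discriminant :: "rat \<Rightarrow> rat \<Rightarrow> nat" where
  "quat_discriminant a b = \<Prod>{l. prime l \<and> ramified a b l}"

definition quat_order :: "rat \<Rightarrow> rat \<Rightarrow> (rat^4) set \<Rightarrow> bool" where
  "quat_order a b A \<longleftrightarrow>
     qone \<in> A \<and> (\<forall>x\<in>A. \<forall>y\<in>A. x - y \<in> A \<and> qmul a b x y \<in> A) \<and>
     (\<exists>S. finite S \<and> A = {\<Sum>s\<in>S. of_int (c s) *s s | c. True}) \<and>
     (\<forall>x. \<exists>m::nat. m > 0 \<and> of_nat m *s x \<in> A)"

definition maximal_order :: "rat \<Rightarrow> rat \<Rightarrow> (rat^4) set \<Rightarrow> bool" where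
  "maximal_order a b A \<longleftrightarrow>
     quat_order a b A \<and> (\<forall>A'. quat_order a b A' \<and> A \<subseteq> A' \<longrightarrow> A' = A)"

text \<open>
  An Eichler order is an intersection of two maximal orders, and its level is its index in
  (either) one of them.
\<close>

definition eichler_order :: "rat \<Rightarrow> rat \<Rightarrow> nat \<Rightarrow> (rat^4) set \<Rightarrow> bool" where
  "eichler_order a b M A \<longleftrightarrow>
     (\<exists>A1 A2. maximal_order a b A1 \<and> maximal_order a b A2 \<and> A = A1 \<inter> A2 \<and>
        finite ((\<lambda>x. (+) x ` A) ` A1) \<and> card ((\<lambda>x. (+) x ` A) ` A1) = M)"

text \<open>\<open>A \<otimes> \<int>[1/p]\<close>, as a subset of \<open>B\<close>.\<close>

definition invert_p :: "nat \<Rightarrow> (rat^4) set \<Rightarrow> (rat^4) set" where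
  "invert_p p A = {(1 / of_nat p ^ m) *s x | m x. x \<in> A}"

definition norm_one_group :: "rat \<Rightarrow> rat \<Rightarrow> nat \<Rightarrow> (rat^4) set \<Rightarrow> (rat^4) monoid" where
  "norm_one_group a b p A =
     \<lparr>carrier = {x \<in> invert_p p A. reduced_norm a b x = 1}, mult = qmul a b, one = qone\<rparr>"

text \<open>
  \<open>B \<otimes> \<rat>\<^sub>p\<close> consists of the vectors in \<open>K\<^sub>p^4\<close> with coordinates in \<open>\<rat>\<^sub>p\<close>. Values of \<open>\<iota>\<close> outside it
  are irrelevant.
\<close>

definition splitting ::
  "('k::field_char_0 \<Rightarrow> real) \<Rightarrow> rat \<Rightarrow> rat \<Rightarrow> ('k^4 \<Rightarrow> 'k^2^2) \<Rightarrow> bool" where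
  "splitting nrm a b \<iota> \<longleftrightarrow>
     (let BQp = {x. \<forall>i. x $ i \<in> Qp nrm} in
      bij_betw \<iota> BQp {m. \<forall>r s. m $ r $ s \<in> Qp nrm} \<and>
      \<iota> qone = mat 1 \<and>
      (\<forall>x\<in>BQp. \<forall>y\<in>BQp. \<iota> (x + y) = \<iota> x + \<iota> y \<and>
                          \<iota> (qmul (of_rat a) (of_rat b) x y) = \<iota> x ** \<iota> y) \<and>
      (\<forall>c\<in>Qp nrm. \<forall>x\<in>BQp. \<forall>r s. \<iota> (c *s x) $ r $ s = c * \<iota> x $ r $ s))"

definition iota_rat :: "('k::field_char_0^4 \<Rightarrow> 'k^2^2) \<Rightarrow> rat^4 \<Rightarrow> 'k^2^2" where
  "iota_rat \<iota> x = \<iota> (\<chi> i. of_rat (x $ i))"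

definition moebius :: "'k::field^2^2 \<Rightarrow> 'k \<Rightarrow> 'k" where
  "moebius m \<tau> = (m$1$1 * \<tau> + m$1$2) / (m$2$1 * \<tau> + m$2$2)"

section \<open>Divisors and one-boundaries\<close>

definition Div :: "'x set \<Rightarrow> ('x \<Rightarrow>\<^sub>0 int) set" where
  "Div H = {D. Poly_Mapping.keys D \<subseteq> H}"

definition deg :: "('x \<Rightarrow>\<^sub>0 int) \<Rightarrow> int" where
  "deg D = (\<Sum>\<tau>\<in>Poly_Mapping.keys D. Poly_Mapping.lookup D \<tau>)"

definition push_div :: "('x \<Rightarrow> 'x) \<Rightarrow> ('x \<Rightarrow>\<^sub>0 int) \<Rightarrow> ('x \<Rightarrow>\<^sub>0 int)" where
  "push_div f D =
     (\<Sum>\<tau>\<in>Poly_Mapping.keys D. Poly_Mapping.single (f \<tau>) (Poly_Mapping.lookup D \<tau>))"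

definition div_act ::
  "('k::field_char_0^4 \<Rightarrow> 'k^2^2) \<Rightarrow> rat^4 \<Rightarrow> ('k \<Rightarrow>\<^sub>0 int) \<Rightarrow> ('k \<Rightarrow>\<^sub>0 int)" where
  "div_act \<iota> g = push_div (moebius (iota_rat \<iota> g))"

text \<open>
  For a set \<open>S\<close> and an abelian group \<open>V\<close>, the tensor product \<open>\<int>[S] \<otimes> V\<close> is the direct sum of
  copies of \<open>V\<close> indexed by \<open>S\<close>; the tensor \<open>s \<otimes> v\<close> is \<open>Poly_Mapping.single s v\<close>. Similarly
  \<open>\<int>[S] \<otimes> \<int>[S] \<otimes> V\<close> is the direct sum indexed by \<open>S \<times> S\<close>.
\<close>

definition tensor_chains :: "'s set \<Rightarrow> 'v::ab_group_add set \<Rightarrow> ('s \<Rightarrow>\<^sub>0 'v) set" where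
  "tensor_chains S V = {c. Poly_Mapping.keys c \<subseteq> S \<and> (\<forall>s. Poly_Mapping.lookup c s \<in> V)}"

definition boundary2 ::
  "('g, 'm) monoid_scheme \<Rightarrow> ('g \<Rightarrow> 'v \<Rightarrow> 'v) \<Rightarrow> ('g \<times> 'g \<Rightarrow>\<^sub>0 'v::ab_group_add) \<Rightarrow> ('g \<Rightarrow>\<^sub>0 'v)" where
  "boundary2 G act c = (\<Sum>(g, h)\<in>Poly_Mapping.keys c. let D = Poly_Mapping.lookup c (g, h) in
     Poly_Mapping.single h (act (inv\<^bsub>G\<^esub> g) D) - Poly_Mapping.single (g \<otimes>\<^bsub>G\<^esub> h) D
     + Poly_Mapping.single g D)"

definition B1 ::
  "('g, 'm) monoid_scheme \<Rightarrow> ('g \<Rightarrow> 'v \<Rightarrow> 'v) \<Rightarrow> 'v::ab_group_add set \<Rightarrow> ('g \<Rightarrow>\<^sub>0 'v) set" where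
  "B1 G act V = boundary2 G act ` tensor_chains (carrier G \<times> carrier G) V"

section \<open>Words and presentations\<close>

text \<open>
  The letter \<open>(i, True)\<close> stands for the generator with index \<open>i\<close>, and \<open>(i, False)\<close> for its inverse.
  Generators are indexed by \<open>0, \<dots>, n - 1\<close>.
\<close>

type_synonym word = "(nat \<times> bool) list"

definition words :: "nat \<Rightarrow> word set" where
  "words n = {w. \<forall>(i, e)\<in>set w. i < n}"

definition word_val :: "('g, 'm) monoid_scheme \<Rightarrow> (nat \<Rightarrow> 'g) \<Rightarrow> word \<Rightarrow> 'g" where
  "word_val G x w =
     foldr (\<lambda>(i, e) h. (if e then x i else inv\<^bsub>G\<^esub> (x i)) \<otimes>\<^bsub>G\<^esub> h) w \<one>\<^bsub>G\<^esub>"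

definition exponent_sum :: "nat \<Rightarrow> word \<Rightarrow> int" where
  "exponent_sum i w = (\<Sum>(j, e)\<leftarrow>w. if j = i then (if e then 1 else - 1) else 0)"

inductive word_equiv :: "nat \<Rightarrow> word set \<Rightarrow> word \<Rightarrow> word \<Rightarrow> bool" for n rels where
  refl: "w \<in> words n \<Longrightarrow> word_equiv n rels w w"
| sym: "word_equiv n rels v w \<Longrightarrow> word_equiv n rels w v"
| trans: "word_equiv n rels u v \<Longrightarrow> word_equiv n rels v w \<Longrightarrow> word_equiv n rels u w"
| cancel: "u \<in> words n \<Longrightarrow> v \<in> words n \<Longrightarrow> i < n \<Longrightarrow>
    word_equiv n rels (u @ [(i, e), (i, \<not> e)] @ v) (u @ v)"
| relator: "u \<in> words n \<Longrightarrow> v \<in> words n \<Longrightarrow> r \<in> rels \<Longrightarrow> word_equiv n rels (u @ r @ v) (u @ v)"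

definition finite_presentation ::
  "('g, 'm) monoid_scheme \<Rightarrow> nat \<Rightarrow> (nat \<Rightarrow> 'g) \<Rightarrow> word set \<Rightarrow> bool" where
  "finite_presentation G n x rels \<longleftrightarrow>
     finite rels \<and> rels \<subseteq> words n \<and> (\<forall>i<n. x i \<in> carrier G) \<and>
     word_val G x ` words n = carrier G \<and>
     (\<forall>u\<in>words n. \<forall>v\<in>words n. word_val G x u = word_val G x v \<longleftrightarrow> word_equiv n rels u v)"

section \<open>Algorithms\<close>

text \<open>
  Elements of \<open>K\<^sub>p\<close> are not finite data, so algorithms are programs with exact arithmetic on scalars:
  a while language with integer and scalar variables and with stacks of integers and of scalars.
  The operations on scalars are the field operations; the only scalar constants are integers and
  the entries \<open>ent i $ r $ s\<close> of finitely many given matrices. Division by zero and popping an empty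
  stack block the execution. There are no tests on scalars, since equality in \<open>K\<^sub>p\<close> cannot be
  decided from approximations. A program is a finite piece of syntax that contains no scalar.
\<close>

datatype iexp = IConst int | IVar nat | IAdd iexp iexp | ISub iexp iexp | IMul iexp iexp

datatype kexp = KVar nat | KInt iexp | KEntry nat 2 2 | KAdd kexp kexp | KSub kexp kexp
  | KMul kexp kexp

datatype test = ILess iexp iexp | IEmpty nat | KEmpty nat | Neg test | Conj test test

datatype prog =
    Skip
  | ISet nat iexp
  | KSet nat kexp
  | KDiv nat kexp kexp
  | IPush nat iexp
  | IPop nat nat
  | KPush nat kexp
  | KPop nat nat
  | Seq prog prog
  | Cond test prog prog
  | Loop test prog

record 'k state =
  ivar :: "nat \<Rightarrow> int"
  kvar :: "nat \<Rightarrow> 'k"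
  istack :: "nat \<Rightarrow> int list"
  kstack :: "nat \<Rightarrow> 'k list"

primrec ieval :: "'k state \<Rightarrow> iexp \<Rightarrow> int" where
  "ieval \<pi> (IConst c) = c"
| "ieval \<pi> (IVar v) = ivar \<pi> v"
| "ieval \<pi> (IAdd e f) = ieval \<pi> e + ieval \<pi> f"
| "ieval \<pi> (ISub e f) = ieval \<pi> e - ieval \<pi> f"
| "ieval \<pi> (IMul e f) = ieval \<pi> e * ieval \<pi> f"

primrec keval :: "(nat \<Rightarrow> 'k::field^2^2) \<Rightarrow> 'k state \<Rightarrow> kexp \<Rightarrow> 'k" where
  "keval ent \<pi> (KVar v) = kvar \<pi> v"
| "keval ent \<pi> (KInt e) = of_int (ieval \<pi> e)"
| "keval ent \<pi> (KEntry i r s) = ent i $ r $ s"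
| "keval ent \<pi> (KAdd e f) = keval ent \<pi> e + keval ent \<pi> f"
| "keval ent \<pi> (KSub e f) = keval ent \<pi> e - keval ent \<pi> f"
| "keval ent \<pi> (KMul e f) = keval ent \<pi> e * keval ent \<pi> f"

primrec holds :: "'k state \<Rightarrow> test \<Rightarrow> bool" where
  "holds \<pi> (ILess e f) \<longleftrightarrow> ieval \<pi> e < ieval \<pi> f"
| "holds \<pi> (IEmpty s) \<longleftrightarrow> istack \<pi> s = []"
| "holds \<pi> (KEmpty s) \<longleftrightarrow> kstack \<pi> s = []"
| "holds \<pi> (Neg t) \<longleftrightarrow> \<not> holds \<pi> t"
| "holds \<pi> (Conj t u) \<longleftrightarrow> holds \<pi> t \<and> holds \<pi> u"

text \<open>\<open>exec ent P \<pi> \<rho>\<close>: started in state \<open>\<pi>\<close>, the program \<open>P\<close> terminates in state \<open>\<rho>\<close>.\<close>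

inductive exec :: "(nat \<Rightarrow> 'k::field^2^2) \<Rightarrow> prog \<Rightarrow> 'k state \<Rightarrow> 'k state \<Rightarrow> bool" for ent where
  Skip: "exec ent Skip \<pi> \<pi>"
| ISet: "exec ent (ISet v e) \<pi> (\<pi>\<lparr>ivar := (ivar \<pi>)(v := ieval \<pi> e)\<rparr>)"
| KSet: "exec ent (KSet v e) \<pi> (\<pi>\<lparr>kvar := (kvar \<pi>)(v := keval ent \<pi> e)\<rparr>)"
| KDiv: "keval ent \<pi> f \<noteq> 0 \<Longrightarrow>
    exec ent (KDiv v e f) \<pi> (\<pi>\<lparr>kvar := (kvar \<pi>)(v := keval ent \<pi> e / keval ent \<pi> f)\<rparr>)"
| IPush: "exec ent (IPush s e) \<pi> (\<pi>\<lparr>istack := (istack \<pi>)(s := ieval \<pi> e # istack \<pi> s)\<rparr>)"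
| IPop: "istack \<pi> s = c # cs \<Longrightarrow>
    exec ent (IPop s v) \<pi> (\<pi>\<lparr>ivar := (ivar \<pi>)(v := c), istack := (istack \<pi>)(s := cs)\<rparr>)"
| KPush: "exec ent (KPush s e) \<pi> (\<pi>\<lparr>kstack := (kstack \<pi>)(s := keval ent \<pi> e # kstack \<pi> s)\<rparr>)"
| KPop: "kstack \<pi> s = z # zs \<Longrightarrow>
    exec ent (KPop s v) \<pi> (\<pi>\<lparr>kvar := (kvar \<pi>)(v := z), kstack := (kstack \<pi>)(s := zs)\<rparr>)"
| Seq: "exec ent P \<pi> \<rho> \<Longrightarrow> exec ent Q \<rho> \<omega> \<Longrightarrow> exec ent (Seq P Q) \<pi> \<omega>"
| Cond_True: "holds \<pi> t \<Longrightarrow> exec ent P \<pi> \<rho> \<Longrightarrow> exec ent (Cond t P Q) \<pi> \<rho>"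
| Cond_False: "\<not> holds \<pi> t \<Longrightarrow> exec ent Q \<pi> \<rho> \<Longrightarrow> exec ent (Cond t P Q) \<pi> \<rho>"
| Loop_False: "\<not> holds \<pi> t \<Longrightarrow> exec ent (Loop t P) \<pi> \<pi>"
| Loop_True: "holds \<pi> t \<Longrightarrow> exec ent P \<pi> \<rho> \<Longrightarrow> exec ent (Loop t P) \<rho> \<omega> \<Longrightarrow>
    exec ent (Loop t P) \<pi> \<omega>"

inductive_cases exec_elims:
  "exec ent Skip \<pi> \<rho>" "exec ent (ISet v e) \<pi> \<rho>" "exec ent (KSet v e) \<pi> \<rho>"
  "exec ent (KDiv v e f) \<pi> \<rho>" "exec ent (IPush s e) \<pi> \<rho>" "exec ent (IPop s v) \<pi> \<rho>"
  "exec ent (KPush s k) \<pi> \<rho>" "exec ent (KPop s v) \<pi> \<rho>" "exec ent (Seq P Q) \<pi> \<rho>"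
  "exec ent (Cond t P Q) \<pi> \<rho>" "exec ent (Loop t P) \<pi> \<rho>"

lemma exec_deterministic: "exec ent P \<pi> \<rho> \<Longrightarrow> exec ent P \<pi> \<rho>' \<Longrightarrow> \<rho>' = \<rho>"
proof (induction arbitrary: \<rho>' rule: exec.induct)
  case (Seq P \<pi> \<rho> Q \<omega>)
  then show ?case by (metis exec_elims(9))
next
  case (Cond_True \<pi> t P \<rho> Q)
  then show ?case by (metis exec_elims(10))
next
  case (Cond_False \<pi> t Q \<rho> P)
  then show ?case by (metis exec_elims(10))
next
  case (Loop_False \<pi> t P)
  then show ?case by (metis exec_elims(11))
next
  case (Loop_True \<pi> t P \<rho> \<omega>)
  then show ?case by (metis exec_elims(11))
qed (erule exec_elims; simp)+

text \<open>
  A divisor is given to (and returned by) a program as a formal sum of points of \<open>H\<close>, i.e. a list of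
  multiplicities and a list of points. Repeated points and zero multiplicities are allowed. The
  letter \<open>x\<^sub>i\<^sup>\<plusminus>\<^sup>1\<close> is coded by the integer \<open>\<plusminus>(i + 1)\<close>. The word is on integer stack \<open>0\<close>, the input divisor
  on the integer and scalar stacks \<open>1\<close>, and the output divisors are found on the stacks \<open>2, 3, \<dots>\<close>.
\<close>

definition represents :: "'k set \<Rightarrow> int list \<Rightarrow> 'k list \<Rightarrow> ('k \<Rightarrow>\<^sub>0 int) \<Rightarrow> bool" where
  "represents H cs \<tau>s D \<longleftrightarrow>
     length cs = length \<tau>s \<and> set \<tau>s \<subseteq> H \<and>
     D = (\<Sum>(c, \<tau>)\<leftarrow>zip cs \<tau>s. Poly_Mapping.single \<tau> c)"

definition code_word :: "word \<Rightarrow> int list" where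
  "code_word w = map (\<lambda>(i, e). if e then int i + 1 else - (int i + 1)) w"

definition input_state :: "word \<Rightarrow> int list \<Rightarrow> 'k::field list \<Rightarrow> 'k state" where
  "input_state w cs \<tau>s =
     \<lparr>ivar = (\<lambda>_. 0), kvar = (\<lambda>_. 0),
      istack = (\<lambda>_. [])(0 := code_word w, 1 := cs), kstack = (\<lambda>_. [])(1 := \<tau>s)\<rparr>"

definition output_divisors ::
  "'k set \<Rightarrow> nat \<Rightarrow> 'k state \<Rightarrow> (nat \<Rightarrow> ('k \<Rightarrow>\<^sub>0 int)) \<Rightarrow> bool" where
  "output_divisors H n \<rho> Ds \<longleftrightarrow>
     (\<forall>i<n. represents H (istack \<rho> (i + 2)) (kstack \<rho> (i + 2)) (Ds i))"

text \<open>The matrices of the generators, the only data about \<open>\<Gamma>\<close> that programs can access.\<close>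

definition generator_matrices ::
  "('k::field_char_0^4 \<Rightarrow> 'k^2^2) \<Rightarrow> nat \<Rightarrow> (nat \<Rightarrow> rat^4) \<Rightarrow> nat \<Rightarrow> 'k^2^2" where
  "generator_matrices \<iota> n x i = (if i < n then iota_rat \<iota> (x i) else 0)"

end

theory Submission
  imports Defs
begin

text \<open>
  Modulo boundaries, \<open>gh \<otimes> D \<equiv> g \<otimes> D + h \<otimes> g\<inverse>D\<close> splits off the first letter of a word and
  \<open>x\<inverse> \<otimes> D \<equiv> - x \<otimes> xD\<close> removes inverses of generators. Hence a single pass over the word, replacing
  \<open>D\<close> by its translate under the inverse of each letter, adds \<open>D\<close> to \<open>D\<^sub>i\<close> at each \<open>x\<^sub>i\<close> and subtracts
  \<open>x\<^sub>iD\<close> from \<open>D\<^sub>i\<close> at each \<open>x\<^sub>i\<inverse>\<close>; translation preserves degrees. The points can be translated from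
  the matrices of the generators alone: a scalar does not change a Moebius transformation, so the
  adjugate of the matrix of \<open>x\<^sub>i\<close> serves for \<open>x\<^sub>i\<inverse>\<close>. No denominator vanishes, because \<open>\<rat>\<^sub>p\<close> is a field
  that contains the matrix entries but not the points.
\<close>

section \<open>Divisors\<close>

lemma push_div_0 [simp]: "push_div f 0 = 0"
  by (simp add: push_div_def)

lemma push_div_single [simp]: "push_div f (Poly_Mapping.single \<tau> c) = Poly_Mapping.single (f \<tau>) c"
  by (simp add: push_div_def)

text \<open>The summand is additive in the coefficient and vanishes at coefficient 0, so points that
  cancel in \<open>D + E\<close> make no difference.\<close>

lemma push_div_add: "push_div f (D + E) = push_div f D + push_div f E"
  unfolding push_div_def by (rule setsum_keys_plus_distrib) (auto simp: single_add)

lemma push_div_sum: "push_div f (\<Sum>i\<in>I. D i) = (\<Sum>i\<in>I. push_div f (D i))"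
  by (induction I rule: infinite_finite_induct) (auto simp: push_div_add)

lemma push_div_push_div: "push_div f (push_div g D) = push_div (f \<circ> g) D"
  by (simp add: push_div_def[of g] push_div_sum) (simp add: push_div_def)

lemma push_div_cong:
  "(\<And>\<tau>. \<tau> \<in> Poly_Mapping.keys D \<Longrightarrow> f \<tau> = g \<tau>) \<Longrightarrow> push_div f D = push_div g D"
  by (simp add: push_div_def)

lemma push_div_ident: "push_div (\<lambda>\<tau>. \<tau>) D = D"
  by (rule poly_mapping_eqI)
    (auto simp: push_div_def lookup_sum lookup_single when_def in_keys_iff)

lemma deg_0 [simp]: "deg 0 = 0"
  by (simp add: deg_def)

lemma deg_single [simp]: "deg (Poly_Mapping.single \<tau> c) = c"
  by (simp add: deg_def)

lemma deg_add: "deg (D + E) = deg D + deg E"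
  unfolding deg_def by (rule setsum_keys_plus_distrib) auto

lemma deg_uminus: "deg (- D) = - deg D"
  using deg_add[of D "- D"] by simp

lemma deg_sum: "deg (\<Sum>i\<in>I. D i) = (\<Sum>i\<in>I. deg (D i))"
  by (induction I rule: infinite_finite_induct) (auto simp: deg_add)

lemma deg_push_div [simp]: "deg (push_div f D) = deg D"
  by (simp add: push_div_def deg_sum) (simp add: deg_def)

lemma Div_0 [simp]: "0 \<in> Div H"
  by (simp add: Div_def)

lemma Div_single: "\<tau> \<in> H \<Longrightarrow> Poly_Mapping.single \<tau> c \<in> Div H"
  by (simp add: Div_def)

lemma Div_add: "D \<in> Div H \<Longrightarrow> E \<in> Div H \<Longrightarrow> D + E \<in> Div H"
  using keys_add[of D E] by (auto simp: Div_def)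

lemma Div_uminus: "D \<in> Div H \<Longrightarrow> - D \<in> Div H"
  by (simp add: Div_def)

lemma Div_sum: "(\<And>i. i \<in> I \<Longrightarrow> D i \<in> Div H) \<Longrightarrow> (\<Sum>i\<in>I. D i) \<in> Div H"
  by (induction I rule: infinite_finite_induct) (auto intro: Div_add)

lemma push_div_in_Div: "D \<in> Div H \<Longrightarrow> (\<And>\<tau>. \<tau> \<in> H \<Longrightarrow> f \<tau> \<in> H) \<Longrightarrow> push_div f D \<in> Div H"
  unfolding push_div_def by (intro Div_sum Div_single) (auto simp: Div_def)

text \<open>One list of pairs in place of the two parallel lists of \<open>represents\<close>, so
  that arguments about the program become inductions on a single list.\<close>

definition formal_sum :: "(int \<times> 'x) list \<Rightarrow> ('x \<Rightarrow>\<^sub>0 int)" where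
  "formal_sum zs = (\<Sum>(c, \<tau>)\<leftarrow>zs. Poly_Mapping.single \<tau> c)"

lemma formal_sum_Nil [simp]: "formal_sum [] = 0"
  and formal_sum_Cons [simp]:
    "formal_sum (z # zs) = Poly_Mapping.single (snd z) (fst z) + formal_sum zs"
  by (simp_all add: formal_sum_def split_beta)

lemma formal_sum_append: "formal_sum (ys @ zs) = formal_sum ys + formal_sum zs"
  by (simp add: formal_sum_def)

text \<open>Used because moving entries from one stack to another reverses their order.\<close>

lemma formal_sum_rev: "formal_sum (rev zs) = formal_sum zs"
  by (induction zs) (auto simp: formal_sum_append add.commute)

lemma formal_sum_push: "formal_sum (map (\<lambda>(c, \<tau>). (c, f \<tau>)) zs) = push_div f (formal_sum zs)"
  by (induction zs) (auto simp: push_div_add)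

lemma formal_sum_uminus: "formal_sum (map (\<lambda>(c, \<tau>). (- c, \<tau>)) zs) = - formal_sum zs"
  by (induction zs) (auto simp: single_uminus)

lemma formal_sum_in_Div: "snd ` set zs \<subseteq> H \<Longrightarrow> formal_sum zs \<in> Div H"
  by (induction zs) (auto intro: Div_add Div_single)

lemma represents_iff:
  "represents H cs \<tau>s D \<longleftrightarrow>
     (\<exists>zs. cs = map fst zs \<and> \<tau>s = map snd zs \<and> snd ` set zs \<subseteq> H \<and> D = formal_sum zs)"
proof
  assume "represents H cs \<tau>s D"
  then show "\<exists>zs. cs = map fst zs \<and> \<tau>s = map snd zs \<and> snd ` set zs \<subseteq> H \<and> D = formal_sum zs"
    by (intro exI[of _ "zip cs \<tau>s"])
      (auto simp: represents_def formal_sum_def dest: set_zip_rightD)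
next
  assume "\<exists>zs. cs = map fst zs \<and> \<tau>s = map snd zs \<and> snd ` set zs \<subseteq> H \<and> D = formal_sum zs"
  then show "represents H cs \<tau>s D"
    by (auto simp: represents_def formal_sum_def zip_map_fst_snd)
qed

lemma represents_in_Div: "represents H cs \<tau>s D \<Longrightarrow> D \<in> Div H"
  by (auto simp: represents_iff formal_sum_in_Div)

section \<open>One-boundaries and Fox derivatives\<close>

text \<open>The laws are required on \<open>V\<close> only: at points of \<open>Qp nrm\<close> a
  denominator may vanish, and then Moebius transformations need not compose.\<close>

locale group_module = group G for G (structure) +
  fixes act :: "'a \<Rightarrow> 'v \<Rightarrow> 'v::ab_group_add" and V :: "'v set"
  assumes zero_mem: "0 \<in> V"
    and add_mem: "u \<in> V \<Longrightarrow> v \<in> V \<Longrightarrow> u + v \<in> V"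
    and uminus_mem: "v \<in> V \<Longrightarrow> - v \<in> V"
    and act_mem: "g \<in> carrier G \<Longrightarrow> v \<in> V \<Longrightarrow> act g v \<in> V"
    and act_add: "g \<in> carrier G \<Longrightarrow> u \<in> V \<Longrightarrow> v \<in> V \<Longrightarrow> act g (u + v) = act g u + act g v"
    and act_one: "v \<in> V \<Longrightarrow> act \<one> v = v"
    and act_mult: "g \<in> carrier G \<Longrightarrow> h \<in> carrier G \<Longrightarrow> v \<in> V \<Longrightarrow> act (g \<otimes> h) v = act g (act h v)"
begin

section \<open>The boundaries form a subgroup\<close>

lemma act_zero: "g \<in> carrier G \<Longrightarrow> act g 0 = 0"
  using act_add[OF _ zero_mem zero_mem, of g] by simp

lemma act_inv_act: "g \<in> carrier G \<Longrightarrow> v \<in> V \<Longrightarrow> act (inv g) (act g v) = v"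
  by (simp flip: act_mult add: act_one)

lemma boundary2_single:
  assumes "g \<in> carrier G"
  shows "boundary2 G act (Poly_Mapping.single (g, h) v) =
    Poly_Mapping.single h (act (inv g) v) - Poly_Mapping.single (g \<otimes> h) v + Poly_Mapping.single g v"
  using assms by (simp add: boundary2_def act_zero)

text \<open>The boundary of one tensor, cut off to 0 outside the group. Additivity of a sum over
  supports asks that the summand vanish at \<open>0\<close> for every pair, while \<open>act\<close>
  is unconstrained outside \<open>carrier G\<close>.\<close>

definition bdry :: "'a \<times> 'a \<Rightarrow> 'v \<Rightarrow> ('a \<Rightarrow>\<^sub>0 'v)" where
  "bdry = (\<lambda>(g, h) v. if (g, h) \<in> carrier G \<times> carrier G
     then Poly_Mapping.single h (act (inv g) v) - Poly_Mapping.single (g \<otimes> h) v + Poly_Mapping.single g v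
     else 0)"

lemma boundary2_eq:
  assumes "c \<in> tensor_chains (carrier G \<times> carrier G) V"
  shows "boundary2 G act c = (\<Sum>k\<in>Poly_Mapping.keys c. bdry k (Poly_Mapping.lookup c k))"
  unfolding boundary2_def using assms
  by (intro sum.cong) (auto simp: bdry_def tensor_chains_def Let_def)

lemma tensor_chains_add:
  "c \<in> tensor_chains S V \<Longrightarrow> d \<in> tensor_chains S V \<Longrightarrow> c + d \<in> tensor_chains S V"
  using keys_add[of c d] by (auto simp: tensor_chains_def lookup_add intro: add_mem)

lemma tensor_chains_uminus: "c \<in> tensor_chains S V \<Longrightarrow> - c \<in> tensor_chains S V"
  by (auto simp: tensor_chains_def intro: uminus_mem)

lemma boundary2_add:
  assumes "c \<in> tensor_chains (carrier G \<times> carrier G) V" "d \<in> tensor_chains (carrier G \<times> carrier G) V"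
  shows "boundary2 G act (c + d) = boundary2 G act c + boundary2 G act d"
proof -
  have "bdry k 0 = 0" for k
    by (auto simp: bdry_def act_zero split: prod.split)
  moreover have "bdry k (u + v) = bdry k u + bdry k v" if "u \<in> V" "v \<in> V" for k u v
    using that by (auto simp: bdry_def act_add single_add split: prod.split)
  ultimately show ?thesis
    unfolding boundary2_eq[OF assms(1)] boundary2_eq[OF assms(2)]
      boundary2_eq[OF tensor_chains_add[OF assms]]
    using assms by (intro setsum_keys_plus_distrib) (auto simp: tensor_chains_def)
qed

lemma B1_add:
  assumes "y \<in> B1 G act V" "z \<in> B1 G act V"
  shows "y + z \<in> B1 G act V"
proof -
  obtain c d where "c \<in> tensor_chains (carrier G \<times> carrier G) V" "y = boundary2 G act c"
    "d \<in> tensor_chains (carrier G \<times> carrier G) V" "z = boundary2 G act d"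
    using assms unfolding B1_def by blast
  then show ?thesis
    unfolding B1_def using boundary2_add tensor_chains_add by (metis imageI)
qed

lemma B1_uminus:
  assumes "y \<in> B1 G act V"
  shows "- y \<in> B1 G act V"
proof -
  obtain c where c: "c \<in> tensor_chains (carrier G \<times> carrier G) V" "y = boundary2 G act c"
    using assms unfolding B1_def by blast
  have "boundary2 G act (- c) + y = 0"
    using boundary2_add[OF tensor_chains_uminus[OF c(1)] c(1)] c(2) by (simp add: boundary2_def)
  then show ?thesis
    unfolding B1_def using tensor_chains_uminus[OF c(1)] by (metis eq_neg_iff_add_eq_0 imageI)
qed

lemma B1_mult:
  assumes "g \<in> carrier G" "h \<in> carrier G" "v \<in> V"
  shows "Poly_Mapping.single h (act (inv g) v) - Poly_Mapping.single (g \<otimes> h) v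
    + Poly_Mapping.single g v \<in> B1 G act V"
proof -
  have "Poly_Mapping.single (g, h) v \<in> tensor_chains (carrier G \<times> carrier G) V"
    using assms zero_mem by (auto simp: tensor_chains_def lookup_single when_def)
  then show ?thesis
    unfolding B1_def using boundary2_single[OF assms(1)] by (metis imageI)
qed

lemma B1_one: "v \<in> V \<Longrightarrow> Poly_Mapping.single \<one> v \<in> B1 G act V"
  using B1_mult[of \<one> \<one> v] by (simp add: act_one)

text \<open>The boundary of \<open>g \<otimes> inv g \<otimes> act g v\<close> is this sum minus
  \<open>\<one> \<otimes> act g v\<close>, and the latter is a boundary itself.\<close>

lemma B1_inv:
  assumes "g \<in> carrier G" "v \<in> V"
  shows "Poly_Mapping.single (inv g) v + Poly_Mapping.single g (act g v) \<in> B1 G act V"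
  using B1_add[OF B1_mult[of g "inv g" "act g v"] B1_one[of "act g v"]] assms
  by (simp add: act_inv_act act_mem)

end

text \<open>
  With \<open>T (i, e)\<close> the action of the inverse of the letter \<open>(i, e)\<close>, this is the \<open>i\<close>-th Fox derivative
  of \<open>w\<close>, followed by \<open>g \<mapsto> g\<inverse>\<close> and applied to \<open>v\<close>.
\<close>

primrec fox :: "(nat \<times> bool \<Rightarrow> 'v \<Rightarrow> 'v) \<Rightarrow> word \<Rightarrow> 'v \<Rightarrow> nat \<Rightarrow> 'v::ab_group_add" where
  "fox T [] v j = 0"
| "fox T (l # w) v j =
     (if j = fst l then if snd l then v else - T l v else 0) + fox T w (T l v) j"

text \<open>As \<open>T\<close> preserves degrees, each letter with index \<open>j\<close>
  contributes \<open>deg D\<close> or \<open>- deg D\<close> according to its exponent.\<close>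

lemma deg_fox:
  assumes "\<And>l D. deg (T l D) = deg D"
  shows "deg (fox T w D j) = exponent_sum j w * deg D"
  by (induction w arbitrary: D)
    (auto simp: exponent_sum_def deg_add deg_uminus assms algebra_simps)

lemma words_Nil [simp]: "[] \<in> words n"
  and words_Cons [simp]: "l # w \<in> words n \<longleftrightarrow> fst l < n \<and> w \<in> words n"
  and words_append [simp]: "u @ w \<in> words n \<longleftrightarrow> u \<in> words n \<and> w \<in> words n"
  by (auto simp: words_def)

text \<open>Induction on the word with \<open>v\<close> arbitrary, because splitting off the first
  letter leaves the tail paired with the translate \<open>T l v\<close>.\<close>

lemma (in group_module) single_eq_sum_fox_mod_B1:
  assumes x: "\<And>i. i < n \<Longrightarrow> x i \<in> carrier G"
    and w: "w \<in> words n" and v: "v \<in> V"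
  defines "T \<equiv> \<lambda>(i, e). act (if e then inv (x i) else x i)"
  shows "word_val G x w \<in> carrier G \<and>
    Poly_Mapping.single (word_val G x w) v - (\<Sum>j<n. Poly_Mapping.single (x j) (fox T w v j))
      \<in> B1 G act V"
  using w v
proof (induction w arbitrary: v)
  case Nil
  then show ?case by (simp add: word_val_def B1_one)
next
  case (Cons l w)
  obtain i e where l: "l = (i, e)" by force
  define s where "s = (if e then x i else inv (x i))"
  have i: "i < n" and w: "w \<in> words n" using Cons.prems l by auto
  have s: "s \<in> carrier G" using x[OF i] by (simp add: s_def)
  have T: "T l v = act (inv s) v" using x[OF i] by (simp add: T_def l s_def)
  have g: "word_val G x (l # w) = s \<otimes> word_val G x w" by (simp add: word_val_def l s_def)
  define S where "S = (\<Sum>j<n. Poly_Mapping.single (x j) (fox T w (T l v) j))"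
  have Tv: "T l v \<in> V" using T act_mem[of "inv s"] s Cons.prems by simp
  have IH: "word_val G x w \<in> carrier G"
    "Poly_Mapping.single (word_val G x w) (T l v) - S \<in> B1 G act V"
    using Cons.IH[OF w Tv] unfolding S_def by auto
  have sum: "(\<Sum>j<n. Poly_Mapping.single (x j) (fox T (l # w) v j)) =
      Poly_Mapping.single (x i) (if e then v else - T l v) + S"
  proof -
    have "(\<Sum>j<n. Poly_Mapping.single (x j) (fox T (l # w) v j)) =
      (\<Sum>j<n. if j = i then Poly_Mapping.single (x i) (if e then v else - T l v) else 0) + S"
      unfolding S_def sum.distrib[symmetric]
      by (intro sum.cong) (auto simp: l single_add)
    also have "\<dots> = Poly_Mapping.single (x i) (if e then v else - T l v) + S"
      using i by simp
    finally show ?thesis .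
  qed
  \<comment> \<open>Added to the induction hypothesis, this cancels the tail and leaves the whole
    word minus the tensor of its first letter \<open>s\<close> minus \<open>S\<close>.\<close>
  have mult: "- (Poly_Mapping.single (word_val G x w) (T l v)
      - Poly_Mapping.single (s \<otimes> word_val G x w) v + Poly_Mapping.single s v) \<in> B1 G act V"
    unfolding T using s IH(1) Cons.prems by (intro B1_uminus B1_mult) auto
  have "Poly_Mapping.single (s \<otimes> word_val G x w) v
      - (Poly_Mapping.single (x i) (if e then v else - T l v) + S) \<in> B1 G act V"
  proof (cases e)
    case True
    then show ?thesis using B1_add[OF IH(2) mult] by (simp add: s_def algebra_simps)
  next
    \<comment> \<open>Here \<open>s = inv (x i)\<close> and \<open>T l v = act (x i) v\<close>, so
      \<open>B1_inv\<close> turns the tensor of \<open>s\<close> into minus that of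
      \<open>x i\<close>.\<close>
    case False
    then show ?thesis
      using B1_add[OF B1_add[OF IH(2) mult] B1_inv[OF x[OF i], of v]] Cons.prems x[OF i]
      by (simp add: s_def T single_uminus algebra_simps)
  qed
  then show ?case using s IH(1) by (simp add: g sum del: fox.simps)
qed

lemma word_val_Nil [simp]: "word_val G x [] = \<one>\<^bsub>G\<^esub>"
  by (simp add: word_val_def)

text \<open>
  Inverses come from the presentation, because it makes \<open>x\<^sub>i x\<^sub>i\<inverse>\<close> equivalent to the empty word:
  no integrality of conjugates in the quaternion order is needed.
\<close>

lemma group_of_presentation:
  fixes G (structure)
  assumes pres: "finite_presentation G n x rels"
    and assoc: "\<And>u v w. (u \<otimes> v) \<otimes> w = u \<otimes> (v \<otimes> w)"
    and l_one: "\<And>u. \<one> \<otimes> u = u"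
  shows "group G"
proof -
  have val: "word_val G x ` words n = carrier G"
    and eq: "\<And>u v. u \<in> words n \<Longrightarrow> v \<in> words n \<Longrightarrow> word_equiv n rels u v \<Longrightarrow>
      word_val G x u = word_val G x v"
    using pres by (auto simp: finite_presentation_def)
  have app: "word_val G x (u @ v) = word_val G x u \<otimes> word_val G x v" for u v
    by (induction u) (auto simp: word_val_def l_one assoc)
  \<comment> \<open>At this stage \<open>inv\<close> in \<open>word_val\<close> is only a
    description without known properties, so the inverse is found as a word, through the relation
    \<open>word_equiv\<close>.\<close>
  have inv: "\<exists>v\<in>words n. word_val G x (v @ w) = \<one>" if "w \<in> words n" for w
    using that
  proof (induction w)
    case Nil
    then show ?case by (intro bexI[of _ "[]"]) auto
  next
    case (Cons l w)
    then obtain v where v: "v \<in> words n" "word_val G x (v @ w) = \<one>" by auto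
    \<comment> \<open>The letter opposite to \<open>l\<close> goes at the end of \<open>v\<close>,
      next to \<open>l\<close>; the double negation matches the shape of the rule
      \<open>cancel\<close>.\<close>
    have "word_equiv n rels (v @ [(fst l, \<not> snd l), (fst l, \<not> \<not> snd l)] @ w) (v @ w)"
      using v Cons.prems by (intro word_equiv.cancel) auto
    from eq[OF _ _ this] have "word_val G x ((v @ [(fst l, \<not> snd l)]) @ l # w) = \<one>"
      using v Cons.prems by simp
    then show ?case using v Cons.prems by (intro bexI[of _ "v @ [(fst l, \<not> snd l)]"]) auto
  qed
  show ?thesis
  proof (rule groupI)
    show "\<one> \<in> carrier G" unfolding val[symmetric] by (intro image_eqI[of _ _ "[]"]) auto
    show "g \<otimes> h \<in> carrier G" if "g \<in> carrier G" "h \<in> carrier G" for g h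
      using that unfolding val[symmetric] by (auto simp flip: app)
    show "\<exists>h\<in>carrier G. h \<otimes> g = \<one>" if "g \<in> carrier G" for g
      using that inv unfolding val[symmetric] by (force simp: app)
  qed (auto simp: assoc l_one)
qed

section \<open>Moebius transformations on the p-adic upper half plane\<close>

locale nonarchimedean_abs =
  fixes nrm :: "'k::field_char_0 \<Rightarrow> real"
  assumes nonneg: "nrm x \<ge> 0"
    and eq_0_iff: "nrm x = 0 \<longleftrightarrow> x = 0"
    and mult: "nrm (x * y) = nrm x * nrm y"
    and ultrametric: "nrm (x + y) \<le> max (nrm x) (nrm y)"
begin

lemma nrm_one: "nrm 1 = 1"
  using mult[of 1 1] eq_0_iff[of 1] by simp

lemma nrm_uminus: "nrm (- x) = nrm x"
proof -
  have "nrm (- 1) * nrm (- 1) = 1" using mult[of "- 1" "- 1"] by (simp add: nrm_one)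
  then have "nrm (- 1) = 1"
    using nonneg[of "- 1"]
    by (metis abs_of_nonneg power2_eq_1_iff power2_eq_square abs_1 abs_minus_cancel)
  then show ?thesis using mult[of "- 1" x] by simp
qed

lemma nrm_inverse: "nrm (inverse x) = inverse (nrm x)"
proof (cases "x = 0")
  case False
  then have "nrm x * nrm (inverse x) = 1" by (simp flip: mult add: nrm_one)
  then show ?thesis by (simp add: inverse_unique)
qed (simp add: eq_0_iff[THEN iffD2])

lemma metric: "Metric_space UNIV (abs_dist nrm)"
proof
  show "abs_dist nrm x y = abs_dist nrm y x" for x y
    using nrm_uminus[of "x - y"] by (simp add: abs_dist_def)
  show "abs_dist nrm x z \<le> abs_dist nrm x y + abs_dist nrm y z" for x y z
    using ultrametric[of "x - y" "y - z"] nonneg[of "x - y"] nonneg[of "y - z"]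
    by (simp add: abs_dist_def)
qed (auto simp: abs_dist_def nonneg eq_0_iff)

section \<open>The closure of the rationals is a subfield\<close>

lemma Qp_iff: "x \<in> Qp nrm \<longleftrightarrow> (\<forall>r>0. \<exists>q\<in>\<rat>. nrm (x - q) < r)"
  by (auto simp: Qp_def Metric_space.metric_closure_of[OF metric] Metric_space.in_mball[OF metric]
    abs_dist_def)

lemma Qp_Rats: "q \<in> \<rat> \<Longrightarrow> q \<in> Qp nrm"
  unfolding Qp_iff using eq_0_iff by (metis cancel_comm_monoid_add_class.diff_cancel)

lemma Qp_add:
  assumes "x \<in> Qp nrm" "y \<in> Qp nrm"
  shows "x + y \<in> Qp nrm"
  unfolding Qp_iff
proof (intro allI impI)
  fix r :: real
  assume "r > 0"
  then obtain q s where "q \<in> \<rat>" "nrm (x - q) < r" "s \<in> \<rat>" "nrm (y - s) < r"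
    using assms unfolding Qp_iff by blast
  then show "\<exists>q\<in>\<rat>. nrm (x + y - q) < r"
    using ultrametric[of "x - q" "y - s"]
    by (intro bexI[of _ "q + s"]) (auto simp: algebra_simps max_def split: if_splits)
qed

lemma Qp_mult:
  assumes "x \<in> Qp nrm" "y \<in> Qp nrm"
  shows "x * y \<in> Qp nrm"
  unfolding Qp_iff
proof (intro allI impI)
  fix r :: real
  assume r: "r > 0"
  \<comment> \<open>From \<open>x * y - q * s = (x - q) * s + x * (y - s)\<close>: \<open>A\<close>
    bounds \<open>nrm s\<close> once \<open>s\<close> is within 1 of \<open>y\<close>, and
    \<open>B\<close> is a bound for \<open>nrm x\<close> that is positive even if
    \<open>x = 0\<close>.\<close>
  define A where "A = max 1 (nrm y)"
  define B where "B = 1 + nrm x"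
  have A: "A \<ge> 1" and B: "B > 0" using nonneg[of x] by (auto simp: A_def B_def)
  obtain s where s: "s \<in> \<rat>" "nrm (y - s) < min 1 (r / B)"
    using assms(2) r B unfolding Qp_iff by (metis divide_pos_pos min_less_iff_conj zero_less_one)
  obtain q where q: "q \<in> \<rat>" "nrm (x - q) < r / A"
    using assms(1) r A unfolding Qp_iff by (metis divide_pos_pos less_le_trans zero_less_one)
  have "nrm s \<le> A"
    using ultrametric[of y "- (y - s)"] s(2)
    unfolding nrm_uminus by (simp add: A_def max_def split: if_splits)
  then have "nrm ((x - q) * s) \<le> nrm (x - q) * A"
    unfolding mult using nonneg by (intro mult_left_mono)
  also have "\<dots> < r" using q A by (simp add: field_simps)
  finally have 1: "nrm ((x - q) * s) < r" .
  have "nrm (x * (y - s)) \<le> B * nrm (y - s)"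
    unfolding mult using nonneg[of "y - s"] by (intro mult_right_mono) (auto simp: B_def)
  also have "\<dots> < r" using s B by (simp add: field_simps)
  finally have 2: "nrm (x * (y - s)) < r" .
  have "nrm (x * y - q * s) < r"
    using ultrametric[of "(x - q) * s" "x * (y - s)"] 1 2 by (simp add: algebra_simps)
  then show "\<exists>q\<in>\<rat>. nrm (x * y - q) < r" using q(1) s(1) Rats_mult by blast
qed

lemma Qp_uminus: "x \<in> Qp nrm \<Longrightarrow> - x \<in> Qp nrm"
  using Qp_mult[OF Qp_Rats[of "- 1"], of x] by simp

lemma Qp_inverse:
  assumes "x \<in> Qp nrm"
  shows "inverse x \<in> Qp nrm"
proof (cases "x = 0")
  case False
  then have x: "nrm x > 0" using nonneg[of x] eq_0_iff[of x] by linarith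
  show ?thesis
    unfolding Qp_iff
  proof (intro allI impI)
    fix r :: real
    assume "r > 0"
    \<comment> \<open>The first bound forces \<open>nrm q \<ge> nrm x\<close> by the ultrametric
      inequality, so \<open>q \<noteq> 0\<close>; the second then makes the difference of the
      inverses smaller than \<open>r\<close>.\<close>
    then obtain q where q: "q \<in> \<rat>" "nrm (x - q) < min (nrm x) (r * nrm x * nrm x)"
      using assms x unfolding Qp_iff by (metis min_less_iff_conj mult_pos_pos)
    have le: "nrm x \<le> nrm q" using ultrametric[of "x - q" q] q(2) by (simp add: max_def split: if_splits)
    then have "q \<noteq> 0" using x eq_0_iff[of 0] by auto
    then have "inverse x - inverse q = - (x - q) * inverse x * inverse q"
      using False by (simp add: field_simps)
    then have "nrm (inverse x - inverse q) = nrm (x - q) / nrm x / nrm q"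
      by (simp only: mult nrm_inverse nrm_uminus divide_inverse)
    also have "\<dots> \<le> nrm (x - q) / nrm x / nrm x"
      using le x nonneg[of "x - q"] by (intro divide_left_mono) (auto simp: zero_less_mult_iff)
    also have "\<dots> < r" using q(2) x by (simp add: field_simps)
    finally show "\<exists>q\<in>\<rat>. nrm (inverse x - q) < r" using q(1) Rats_inverse by blast
  qed
qed (use assms in simp)

lemma Qp_divide: "x \<in> Qp nrm \<Longrightarrow> y \<in> Qp nrm \<Longrightarrow> x / y \<in> Qp nrm"
  by (simp add: divide_inverse Qp_mult Qp_inverse)

text \<open>A zero would give \<open>\<tau> = - d / c\<close>, an element of
  \<open>Qp nrm\<close>.\<close>

lemma Hp_denominator_nonzero:
  assumes "c \<in> Qp nrm" "d \<in> Qp nrm" "\<tau> \<in> Hp nrm" "c \<noteq> 0 \<or> d \<noteq> 0"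
  shows "c * \<tau> + d \<noteq> 0"
proof
  assume 0: "c * \<tau> + d = 0"
  then have "c \<noteq> 0" using assms(4) by auto
  then have "\<tau> = (- d) / c" using 0 by (simp add: field_simps eq_neg_iff_add_eq_0)
  then show False using assms Qp_divide[OF Qp_uminus] by (auto simp: Hp_def)
qed

end

section \<open>Moebius transformations over a field\<close>

lemma mat2_mult: "(A ** B) $ r $ s = A $ r $ 1 * B $ 1 $ s + A $ r $ 2 * B $ 2 $ s"
  for A B :: "'k::field^2^2"
  by (simp add: matrix_matrix_mult_def sum_2)

text \<open>In homogeneous coordinates \<open>B\<close> sends \<open>\<tau>\<close> to
  \<open>(u, v)\<close>, and the factor \<open>v\<close> cancels. If the denominator for
  \<open>A\<close> vanishes, both sides are 0 by the convention for division.\<close>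

lemma moebius_mult:
  assumes "B $ 2 $ 1 * \<tau> + B $ 2 $ 2 \<noteq> 0"
  shows "moebius (A ** B) \<tau> = moebius A (moebius B \<tau>)"
proof -
  define u v where "u = B $ 1 $ 1 * \<tau> + B $ 1 $ 2" and "v = B $ 2 $ 1 * \<tau> + B $ 2 $ 2"
  have v: "v \<noteq> 0" using assms by (simp add: v_def)
  have "A $ r $ 1 * (u / v) + A $ r $ 2 = (A $ r $ 1 * u + A $ r $ 2 * v) / v" for r
    using v by (simp add: field_simps)
  then have "moebius A (u / v) = (A $ 1 $ 1 * u + A $ 1 $ 2 * v) / (A $ 2 $ 1 * u + A $ 2 $ 2 * v)"
    using v by (simp add: moebius_def)
  then show ?thesis
    by (simp add: moebius_def mat2_mult u_def v_def algebra_simps)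
qed

lemma moebius_one: "moebius (mat 1) = (\<lambda>\<tau>. \<tau>)"
  by (simp add: moebius_def mat_def fun_eq_iff)

text \<open>The right-hand side belongs to the adjugate of \<open>B\<close>, which is
  \<open>d\<close> times \<open>A\<close> for the determinant \<open>d\<close> of \<open>B\<close>;
  the nonzero factor \<open>d\<close> cancels.\<close>

lemma moebius_left_inverse:
  fixes A B :: "'k::field^2^2"
  assumes "A ** B = mat 1"
  shows "moebius A \<tau> = (B $ 2 $ 2 * \<tau> - B $ 1 $ 2) / (B $ 1 $ 1 - B $ 2 $ 1 * \<tau>)"
proof -
  define d where "d = B $ 1 $ 1 * B $ 2 $ 2 - B $ 1 $ 2 * B $ 2 $ 1"
  have e: "A $ 1 $ 1 * B $ 1 $ 1 + A $ 1 $ 2 * B $ 2 $ 1 = 1"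
    "A $ 1 $ 1 * B $ 1 $ 2 + A $ 1 $ 2 * B $ 2 $ 2 = 0"
    "A $ 2 $ 1 * B $ 1 $ 1 + A $ 2 $ 2 * B $ 2 $ 1 = 0"
    "A $ 2 $ 1 * B $ 1 $ 2 + A $ 2 $ 2 * B $ 2 $ 2 = 1"
    unfolding mat2_mult[symmetric] assms by (simp_all add: mat_def)
  have 1: "B $ 2 $ 2 = A $ 1 $ 1 * d" "- B $ 1 $ 2 = A $ 1 $ 2 * d"
    "- B $ 2 $ 1 = A $ 2 $ 1 * d" "B $ 1 $ 1 = A $ 2 $ 2 * d"
    unfolding d_def using e by algebra+
  have "d \<noteq> 0"
  proof
    assume "d = 0"
    then have "B $ r $ s = 0" for r s using 1 exhaust_2[of r] exhaust_2[of s] by auto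
    then show False using e by simp
  qed
  moreover have "B $ 2 $ 2 * \<tau> - B $ 1 $ 2 = d * (A $ 1 $ 1 * \<tau> + A $ 1 $ 2)"
    "B $ 1 $ 1 - B $ 2 $ 1 * \<tau> = d * (A $ 2 $ 1 * \<tau> + A $ 2 $ 2)"
    using 1 by algebra+
  ultimately show ?thesis by (simp add: moebius_def)
qed

text \<open>The transformation of \<open>B\<close> undoes that of \<open>A\<close> at
  \<open>\<tau>\<close> and preserves \<open>Qp nrm\<close>, so an image in \<open>Qp nrm\<close>
  would bring \<open>\<tau>\<close> there too.\<close>

lemma (in nonarchimedean_abs) moebius_Hp:
  assumes A: "\<And>r s. A $ r $ s \<in> Qp nrm" and B: "\<And>r s. B $ r $ s \<in> Qp nrm"
    and BA: "B ** A = mat 1" and \<tau>: "\<tau> \<in> Hp nrm"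
  shows "A $ 2 $ 1 * \<tau> + A $ 2 $ 2 \<noteq> 0" and "moebius A \<tau> \<in> Hp nrm"
proof -
  \<comment> \<open>If the lower row of \<open>A\<close> were zero, the first and third equations
    would force \<open>A $ 1 $ 1 = 0\<close>, against the second.\<close>
  have "B $ 2 $ 1 * A $ 1 $ 2 + B $ 2 $ 2 * A $ 2 $ 2 = 1"
    "B $ 1 $ 1 * A $ 1 $ 1 + B $ 1 $ 2 * A $ 2 $ 1 = 1"
    "B $ 2 $ 1 * A $ 1 $ 1 + B $ 2 $ 2 * A $ 2 $ 1 = 0"
    unfolding mat2_mult[symmetric] BA by (simp_all add: mat_def)
  then have "A $ 2 $ 1 \<noteq> 0 \<or> A $ 2 $ 2 \<noteq> 0" by auto
  then show den: "A $ 2 $ 1 * \<tau> + A $ 2 $ 2 \<noteq> 0"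
    using A \<tau> by (intro Hp_denominator_nonzero)
  have "moebius B (moebius A \<tau>) = \<tau>"
    using moebius_mult[OF den, of B] by (simp add: BA moebius_one)
  \<comment> \<open>A vanishing denominator does no harm here: the quotient is then 0, which lies in
    \<open>Qp nrm\<close>.\<close>
  moreover have "moebius B z \<in> Qp nrm" if "z \<in> Qp nrm" for z
    unfolding moebius_def using B that by (intro Qp_divide Qp_add Qp_mult)
  ultimately show "moebius A \<tau> \<in> Hp nrm"
    using \<tau> by (metis DiffD2 DiffI Hp_def UNIV_I)
qed

section \<open>Quaternion coordinates and the splitting at p\<close>

lemma vector_4 [simp]:
  "(vector [x, y, z, t] :: 'a::zero^4) $ 1 = x"
  "(vector [x, y, z, t] :: 'a::zero^4) $ 2 = y"
  "(vector [x, y, z, t] :: 'a::zero^4) $ 3 = z"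
  "(vector [x, y, z, t] :: 'a::zero^4) $ 4 = t"
  unfolding vector_def by simp_all

lemma qmul_nth:
  "qmul a b x y $ 1 = x$1 * y$1 + a * x$2 * y$2 + b * x$3 * y$3 - a * b * x$4 * y$4"
  "qmul a b x y $ 2 = x$1 * y$2 + x$2 * y$1 - b * x$3 * y$4 + b * x$4 * y$3"
  "qmul a b x y $ 3 = x$1 * y$3 + x$3 * y$1 + a * x$2 * y$4 - a * x$4 * y$2"
  "qmul a b x y $ 4 = x$1 * y$4 + x$4 * y$1 + x$2 * y$3 - x$3 * y$2"
  by (simp_all add: qmul_def)

lemma qmul_assoc: "qmul a b (qmul a b u v) w = qmul a b u (qmul a b v w)"
  unfolding vec_eq_iff forall_4 qmul_nth by (intro conjI; algebra)

lemma qmul_qone: "qmul a b qone u = u"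
  by (simp add: qmul_nth qone_def vec_eq_iff forall_4)

lemma (in nonarchimedean_abs)
  assumes "splitting nrm a b \<iota>"
  shows iota_rat_Qp: "iota_rat \<iota> u $ r $ s \<in> Qp nrm"
    and iota_rat_one: "iota_rat \<iota> qone = mat 1"
    and iota_rat_mult: "iota_rat \<iota> (qmul a b u v) = iota_rat \<iota> u ** iota_rat \<iota> v"
proof -
  \<comment> \<open>The inclusion of the rational algebra in its base change; membership is recorded
    since \<open>\<iota>\<close> is constrained only on vectors over \<open>Qp nrm\<close>.\<close>
  define emb :: "rat^4 \<Rightarrow> 'k^4" where "emb = (\<lambda>u. \<chi> i. of_rat (u $ i))"
  have emb: "emb u \<in> {x. \<forall>i. x $ i \<in> Qp nrm}" for u
    by (auto simp: emb_def intro: Qp_Rats)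
  have iota: "iota_rat \<iota> u = \<iota> (emb u)" for u by (simp add: iota_rat_def emb_def)
  have bij: "bij_betw \<iota> {x. \<forall>i. x $ i \<in> Qp nrm} {m. \<forall>r s. m $ r $ s \<in> Qp nrm}"
    and one: "\<iota> qone = mat 1"
    using assms unfolding splitting_def Let_def by blast+
  have mult: "\<iota> (qmul (of_rat a) (of_rat b) y z) = \<iota> y ** \<iota> z"
      if "y \<in> {x. \<forall>i. x $ i \<in> Qp nrm}" "z \<in> {x. \<forall>i. x $ i \<in> Qp nrm}" for y z
    using assms that unfolding splitting_def Let_def by blast
  show "iota_rat \<iota> u $ r $ s \<in> Qp nrm"
    using bij_betwE[OF bij] emb[of u] unfolding iota by blast
  have "emb qone = qone"
    by (simp add: emb_def qone_def vec_eq_iff forall_4)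
  then show "iota_rat \<iota> qone = mat 1" by (simp add: iota one)
  have "emb (qmul a b u v) = qmul (of_rat a) (of_rat b) (emb u) (emb v)"
    by (simp add: emb_def qmul_nth vec_eq_iff forall_4 of_rat_add of_rat_diff of_rat_mult)
  then show "iota_rat \<iota> (qmul a b u v) = iota_rat \<iota> u ** iota_rat \<iota> v"
    by (simp add: iota mult[OF emb emb])
qed

section \<open>The program\<close>

text \<open>The weakest precondition for total correctness: the existential asserts termination, and
  \<open>exec\<close> is deterministic.\<close>

definition runs ::
  "(nat \<Rightarrow> 'k::field^2^2) \<Rightarrow> prog \<Rightarrow> 'k state \<Rightarrow> ('k state \<Rightarrow> bool) \<Rightarrow> bool" where
  "runs ent P \<pi> Q \<longleftrightarrow> (\<exists>\<rho>. exec ent P \<pi> \<rho> \<and> Q \<rho>)"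

lemma runs_simps [simp]:
  "runs ent Skip \<pi> Q \<longleftrightarrow> Q \<pi>"
  "runs ent (KDiv v k f) \<pi> Q \<longleftrightarrow> keval ent \<pi> f \<noteq> 0 \<and>
     Q (\<pi>\<lparr>kvar := (kvar \<pi>)(v := keval ent \<pi> k / keval ent \<pi> f)\<rparr>)"
  "runs ent (IPush s e) \<pi> Q \<longleftrightarrow> Q (\<pi>\<lparr>istack := (istack \<pi>)(s := ieval \<pi> e # istack \<pi> s)\<rparr>)"
  "runs ent (KPush s k) \<pi> Q \<longleftrightarrow> Q (\<pi>\<lparr>kstack := (kstack \<pi>)(s := keval ent \<pi> k # kstack \<pi> s)\<rparr>)"
  "runs ent (IPop s v) \<pi> Q \<longleftrightarrow> (\<exists>c cs. istack \<pi> s = c # cs \<and>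
     Q (\<pi>\<lparr>ivar := (ivar \<pi>)(v := c), istack := (istack \<pi>)(s := cs)\<rparr>))"
  "runs ent (KPop s v) \<pi> Q \<longleftrightarrow> (\<exists>z zs. kstack \<pi> s = z # zs \<and>
     Q (\<pi>\<lparr>kvar := (kvar \<pi>)(v := z), kstack := (kstack \<pi>)(s := zs)\<rparr>))"
  "runs ent (Seq P P') \<pi> Q \<longleftrightarrow> runs ent P \<pi> (\<lambda>\<rho>. runs ent P' \<rho> Q)"
  "runs ent (Cond t P P') \<pi> Q \<longleftrightarrow> (if holds \<pi> t then runs ent P \<pi> Q else runs ent P' \<pi> Q)"
  unfolding runs_def by (auto elim!: exec_elims intro: exec.intros)

lemma runs_Loop:
  "runs ent (Loop t P) \<pi> Q \<longleftrightarrow>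
     (if holds \<pi> t then runs ent P \<pi> (\<lambda>\<rho>. runs ent (Loop t P) \<rho> Q) else Q \<pi>)"
  unfolding runs_def by (auto elim: exec_elims(11) intro: Loop_True Loop_False)

text \<open>The inverse of the letter acts on the point in scalar variable 0: for \<open>e\<close>
  true the fraction is that of the adjugate of the generator's matrix, otherwise that of the matrix
  itself.\<close>

definition numerator :: "nat \<Rightarrow> bool \<Rightarrow> kexp" where
  "numerator i e = (if e then KSub (KMul (KEntry i 2 2) (KVar 0)) (KEntry i 1 2)
     else KAdd (KMul (KEntry i 1 1) (KVar 0)) (KEntry i 1 2))"

definition denominator :: "nat \<Rightarrow> bool \<Rightarrow> kexp" where
  "denominator i e = (if e then KSub (KEntry i 1 1) (KMul (KEntry i 2 1) (KVar 0))
     else KAdd (KMul (KEntry i 2 1) (KVar 0)) (KEntry i 2 2))"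

text \<open>
  Stack \<open>n + 2\<close> is scratch space for the translate of the current divisor by the inverse of the
  letter \<open>(i, e)\<close>.
\<close>

definition translate_loop :: "nat \<Rightarrow> nat \<Rightarrow> bool \<Rightarrow> prog" where
  "translate_loop n i e = Loop (Neg (IEmpty 1))
     (Seq (IPop 1 1) (Seq (KPop 1 0) (Seq (KDiv 1 (numerator i e) (denominator i e))
     (Seq (IPush (i + 2) (if e then IVar 1 else ISub (IConst 0) (IVar 1)))
     (Seq (KPush (i + 2) (KVar (if e then 0 else 1)))
     (Seq (IPush (n + 2) (IVar 1)) (KPush (n + 2) (KVar 1))))))))"

text \<open>Moving the translate back reverses it a second time, which restores the original order
  and empties the scratch stack for the next letter.\<close>

definition restore_loop :: "nat \<Rightarrow> prog" where
  "restore_loop n = Loop (Neg (IEmpty (n + 2)))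
     (Seq (IPop (n + 2) 1) (Seq (KPop (n + 2) 0) (Seq (IPush 1 (IVar 1)) (KPush 1 (KVar 0)))))"

definition is_code :: "int \<Rightarrow> test" where
  "is_code c = Conj (Neg (ILess (IVar 0) (IConst c))) (Neg (ILess (IConst c) (IVar 0)))"

text \<open>Stack numbers and matrix indices are fixed in the syntax and cannot be computed from the
  letter read; hence a cascade with a separate copy of the loops for each letter.\<close>

primrec dispatch :: "nat \<Rightarrow> nat \<Rightarrow> prog" where
  "dispatch n 0 = Skip"
| "dispatch n (Suc i) =
     Cond (is_code (int i + 1)) (Seq (translate_loop n i True) (restore_loop n))
     (Cond (is_code (- (int i + 1))) (Seq (translate_loop n i False) (restore_loop n))
     (dispatch n i))"

definition fox_prog :: "nat \<Rightarrow> prog" where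
  "fox_prog n = Loop (Neg (IEmpty 0)) (Seq (IPop 0 0) (dispatch n n))"

text \<open>Only the stacks of the final state are described, since later code assigns variables
  before reading them. The bound on \<open>i\<close> keeps the stacks \<open>1\<close>,
  \<open>i + 2\<close> and \<open>n + 2\<close> distinct.\<close>

lemma runs_translate_loop:
  assumes "i < n"
    and "\<And>\<pi> :: 'k::field state. kvar \<pi> 0 \<in> H \<Longrightarrow> keval ent \<pi> (denominator i e) \<noteq> 0 \<and>
      keval ent \<pi> (numerator i e) / keval ent \<pi> (denominator i e) = f (kvar \<pi> 0)"
    and "istack \<pi> 1 = map fst zs" "kstack \<pi> 1 = map snd zs" "snd ` set zs \<subseteq> H"
    and "\<And>\<rho>. istack \<rho> = (istack \<pi>)(1 := [],
           i + 2 := rev (map (\<lambda>(c, \<tau>). if e then c else - c) zs) @ istack \<pi> (i + 2),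
           n + 2 := rev (map fst zs) @ istack \<pi> (n + 2)) \<Longrightarrow>
         kstack \<rho> = (kstack \<pi>)(1 := [],
           i + 2 := rev (map (\<lambda>(c, \<tau>). if e then \<tau> else f \<tau>) zs) @ kstack \<pi> (i + 2),
           n + 2 := rev (map (\<lambda>(c, \<tau>). f \<tau>) zs) @ kstack \<pi> (n + 2)) \<Longrightarrow> Q \<rho>"
  shows "runs ent (translate_loop n i e) \<pi> Q"
  using assms(3-6)
proof (induction zs arbitrary: \<pi>)
  case Nil
  then show ?case by (auto simp: translate_loop_def runs_Loop fun_upd_idem)
next
  case (Cons z zs)
  define \<pi>' where "\<pi>' = \<pi>\<lparr>ivar := (ivar \<pi>)(1 := fst z),
    kvar := (kvar \<pi>)(0 := snd z, 1 := f (snd z)),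
    istack := (istack \<pi>)(1 := map fst zs,
      i + 2 := (if e then fst z else - fst z) # istack \<pi> (i + 2),
      n + 2 := fst z # istack \<pi> (n + 2)),
    kstack := (kstack \<pi>)(1 := map snd zs,
      i + 2 := (if e then snd z else f (snd z)) # kstack \<pi> (i + 2),
      n + 2 := f (snd z) # kstack \<pi> (n + 2))\<rparr>"
  have "runs ent (translate_loop n i e) \<pi>' Q"
  proof (rule Cons.IH)
    fix \<rho> :: "'k state"
    assume "istack \<rho> = (istack \<pi>')(1 := [],
           i + 2 := rev (map (\<lambda>(c, \<tau>). if e then c else - c) zs) @ istack \<pi>' (i + 2),
           n + 2 := rev (map fst zs) @ istack \<pi>' (n + 2))"
      "kstack \<rho> = (kstack \<pi>')(1 := [],
           i + 2 := rev (map (\<lambda>(c, \<tau>). if e then \<tau> else f \<tau>) zs) @ kstack \<pi>' (i + 2),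
           n + 2 := rev (map (\<lambda>(c, \<tau>). f \<tau>) zs) @ kstack \<pi>' (n + 2))"
    then show "Q \<rho>"
      using \<open>i < n\<close> by (intro Cons.prems(4)) (auto simp: \<pi>'_def fun_eq_iff split_beta)
  qed (use Cons.prems \<open>i < n\<close> in \<open>auto simp: \<pi>'_def\<close>)
  then show ?case
    using Cons.prems(1-3) \<open>i < n\<close> assms(2)
    unfolding translate_loop_def
    by (subst runs_Loop) (cases e; simp add: \<pi>'_def)
qed

lemma runs_restore_loop:
  fixes \<pi> :: "'k::field state"
  assumes "istack \<pi> (n + 2) = map fst zs" "kstack \<pi> (n + 2) = map snd zs"
    and "\<And>\<rho>. istack \<rho> = (istack \<pi>)(n + 2 := [], 1 := rev (map fst zs) @ istack \<pi> 1) \<Longrightarrow>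
         kstack \<rho> = (kstack \<pi>)(n + 2 := [], 1 := rev (map snd zs) @ kstack \<pi> 1) \<Longrightarrow> Q \<rho>"
  shows "runs ent (restore_loop n) \<pi> Q"
  using assms
proof (induction zs arbitrary: \<pi>)
  case Nil
  then show ?case by (auto simp: restore_loop_def runs_Loop fun_upd_idem)
next
  case (Cons z zs)
  define \<pi>' where "\<pi>' = \<pi>\<lparr>ivar := (ivar \<pi>)(1 := fst z), kvar := (kvar \<pi>)(0 := snd z),
    istack := (istack \<pi>)(n + 2 := map fst zs, 1 := fst z # istack \<pi> 1),
    kstack := (kstack \<pi>)(n + 2 := map snd zs, 1 := snd z # kstack \<pi> 1)\<rparr>"
  have "runs ent (restore_loop n) \<pi>' Q"
  proof (rule Cons.IH)
    fix \<rho> :: "'k state"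
    assume "istack \<rho> = (istack \<pi>')(n + 2 := [], 1 := rev (map fst zs) @ istack \<pi>' 1)"
      "kstack \<rho> = (kstack \<pi>')(n + 2 := [], 1 := rev (map snd zs) @ kstack \<pi>' 1)"
    then show "Q \<rho>" by (intro Cons.prems(3)) (auto simp: \<pi>'_def fun_eq_iff)
  qed (auto simp: \<pi>'_def)
  then show ?case
    using Cons.prems(1,2) unfolding restore_loop_def
    by (subst runs_Loop) (simp add: \<pi>'_def)
qed

text \<open>The invariant of the main loop: \<open>w\<close> is the unread rest of the word,
  \<open>D\<close> the current translate and \<open>Ds\<close> what the letters read so far have
  contributed.\<close>

definition loaded ::
  "'k set \<Rightarrow> nat \<Rightarrow> word \<Rightarrow> ('k \<Rightarrow>\<^sub>0 int) \<Rightarrow> (nat \<Rightarrow> ('k \<Rightarrow>\<^sub>0 int)) \<Rightarrow> 'k state \<Rightarrow> bool" where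
  "loaded H n w D Ds \<pi> \<longleftrightarrow> istack \<pi> 0 = code_word w \<and>
     represents H (istack \<pi> 1) (kstack \<pi> 1) D \<and> output_divisors H n \<pi> Ds \<and>
     istack \<pi> (n + 2) = [] \<and> kstack \<pi> (n + 2) = []"

lemma represents_append:
  "represents H cs \<tau>s D \<Longrightarrow> represents H cs' \<tau>s' D' \<Longrightarrow> represents H (cs @ cs') (\<tau>s @ \<tau>s') (D + D')"
  by (auto simp: represents_def)

lemma runs_letter:
  assumes "i < n"
    and expr: "\<And>\<pi> :: 'k::field state. kvar \<pi> 0 \<in> H \<Longrightarrow> keval ent \<pi> (denominator i e) \<noteq> 0 \<and>
      keval ent \<pi> (numerator i e) / keval ent \<pi> (denominator i e) = f (kvar \<pi> 0)"
    and f: "\<And>\<tau>. \<tau> \<in> H \<Longrightarrow> f \<tau> \<in> H"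
    and load: "loaded H n w D Ds \<pi>"
    and Q: "\<And>\<rho>. loaded H n w (push_div f D)
      (Ds(i := Ds i + (if e then D else - push_div f D))) \<rho> \<Longrightarrow> Q \<rho>"
  shows "runs ent (Seq (translate_loop n i e) (restore_loop n)) \<pi> Q"
proof -
  obtain zs where zs: "istack \<pi> 1 = map fst zs" "kstack \<pi> 1 = map snd zs" "snd ` set zs \<subseteq> H"
    and D: "D = formal_sum zs"
    using load unfolding loaded_def represents_iff by blast
  define ys where "ys = map (\<lambda>(c, \<tau>). (c, f \<tau>)) zs"
  have ys: "snd ` set ys \<subseteq> H" "formal_sum ys = push_div f D"
    using zs f by (auto simp: ys_def D formal_sum_push)
  define E where "E = (if e then D else - push_div f D)"
  \<comment> \<open>The entries that the first loop puts on stack \<open>i + 2\<close>, reversed by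
    pushing; they represent the contribution \<open>E\<close>.\<close>
  define us where "us = rev (if e then zs else map (\<lambda>(c, \<tau>). (- c, \<tau>)) ys)"
  have us: "represents H (map fst us) (map snd us) E"
    unfolding represents_iff
    by (rule exI[of _ us])
      (use zs ys in \<open>auto simp: us_def E_def D formal_sum_rev formal_sum_uminus\<close>)
  have maps: "rev (map (\<lambda>(c, \<tau>). if e then c else - c) zs) = map fst us"
    "rev (map (\<lambda>(c, \<tau>). if e then \<tau> else f \<tau>) zs) = map snd us"
    "rev (map fst zs) = map fst (rev ys)" "rev (map (\<lambda>(c, \<tau>). f \<tau>) zs) = map snd (rev ys)"
    by (auto simp: us_def ys_def rev_map split_beta comp_def)
  show ?thesis
    unfolding runs_simps
  proof (rule runs_translate_loop[OF assms(1) expr zs])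
    fix \<rho> :: "'k state"
    assume \<rho>: "istack \<rho> = (istack \<pi>)(1 := [],
           i + 2 := rev (map (\<lambda>(c, \<tau>). if e then c else - c) zs) @ istack \<pi> (i + 2),
           n + 2 := rev (map fst zs) @ istack \<pi> (n + 2))"
      "kstack \<rho> = (kstack \<pi>)(1 := [],
           i + 2 := rev (map (\<lambda>(c, \<tau>). if e then \<tau> else f \<tau>) zs) @ kstack \<pi> (i + 2),
           n + 2 := rev (map (\<lambda>(c, \<tau>). f \<tau>) zs) @ kstack \<pi> (n + 2))"
    note \<rho> = \<rho>[unfolded maps]
    \<comment> \<open>The scratch stack was empty before, so it now holds exactly
      \<open>rev ys\<close>, and the second loop puts \<open>ys\<close> on stack
      \<open>1\<close>.\<close>
    show "runs ent (restore_loop n) \<rho> Q"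
    proof (rule runs_restore_loop[of _ _ "rev ys"])
      show "istack \<rho> (n + 2) = map fst (rev ys)" "kstack \<rho> (n + 2) = map snd (rev ys)"
        using load by (simp_all add: \<rho> loaded_def)
      fix \<omega> :: "'k state"
      assume \<omega>: "istack \<omega> = (istack \<rho>)(n + 2 := [], 1 := rev (map fst (rev ys)) @ istack \<rho> 1)"
         "kstack \<omega> = (kstack \<rho>)(n + 2 := [], 1 := rev (map snd (rev ys)) @ kstack \<rho> 1)"
      have "represents H (map fst ys) (map snd ys) (push_div f D)"
        using ys by (auto simp: represents_iff)
      then show "Q \<omega>"
        using load us \<open>i < n\<close>
        by (intro Q, unfold E_def[symmetric])
          (auto simp: loaded_def output_divisors_def \<rho> \<omega> rev_map[symmetric] add.commute[of "Ds i"]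
             simp del: One_nat_def intro: represents_append)
    qed
  qed
qed

lemma holds_is_code: "holds \<pi> (is_code c) \<longleftrightarrow> ivar \<pi> 0 = c"
  by (auto simp: is_code_def)

text \<open>The shift by 1 makes all codes distinct, including those of generator 0 and its inverse,
  so every test before the one for \<open>(i, e)\<close> fails.\<close>

lemma runs_dispatch:
  assumes "ivar \<pi> 0 = (if e then int i + 1 else - (int i + 1))" "i < m"
    and "runs ent (Seq (translate_loop n i e) (restore_loop n)) \<pi> Q"
  shows "runs ent (dispatch n m) \<pi> Q"
  using assms(2)
proof (induction m)
  case (Suc m)
  then show ?case
    using assms(1,3) by (cases "i = m"; cases e) (auto simp: holds_is_code simp del: runs_simps(7))
qed simp

text \<open>Induction on the word with \<open>D\<close> and the accumulator \<open>Ds\<close>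
  arbitrary, as each letter changes both.\<close>

lemma runs_fox_prog:
  assumes expr: "\<And>i e \<pi> :: 'k::field state. i < n \<Longrightarrow> kvar \<pi> 0 \<in> H \<Longrightarrow>
      keval ent \<pi> (denominator i e) \<noteq> 0 \<and>
      keval ent \<pi> (numerator i e) / keval ent \<pi> (denominator i e) = f (i, e) (kvar \<pi> 0)"
    and f: "\<And>i e \<tau>. i < n \<Longrightarrow> \<tau> \<in> H \<Longrightarrow> f (i, e) \<tau> \<in> H"
    and "w \<in> words n" and "loaded H n w D Ds \<pi>"
  shows "runs ent (fox_prog n) \<pi>
    (\<lambda>\<rho>. output_divisors H n \<rho> (\<lambda>j. Ds j + fox (\<lambda>l. push_div (f l)) w D j))"
  using assms(3,4)
proof (induction w arbitrary: \<pi> D Ds)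
  case Nil
  then show ?case by (simp add: fox_prog_def runs_Loop loaded_def code_word_def)
next
  case (Cons l w)
  obtain i e where l: "l = (i, e)" by force
  have i: "i < n" and w: "w \<in> words n" using Cons.prems l by auto
  define c where "c = (if e then int i + 1 else - (int i + 1))"
  have st: "istack \<pi> 0 = c # code_word w"
    using Cons.prems(2) by (simp add: loaded_def code_word_def l c_def)
  define \<pi>' where "\<pi>' = \<pi>\<lparr>ivar := (ivar \<pi>)(0 := c), istack := (istack \<pi>)(0 := code_word w)\<rparr>"
  have \<pi>': "loaded H n w D Ds \<pi>'" "ivar \<pi>' 0 = c"
    using Cons.prems(2) by (auto simp: \<pi>'_def loaded_def output_divisors_def)
  have "runs ent (dispatch n n) \<pi>' (\<lambda>\<rho>. runs ent (fox_prog n) \<rho>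
    (\<lambda>\<rho>. output_divisors H n \<rho> (\<lambda>j. Ds j + fox (\<lambda>l. push_div (f l)) (l # w) D j)))"
  proof (rule runs_dispatch[OF _ i runs_letter[OF i expr[OF i] f[OF i] \<pi>'(1)]])
    show "ivar \<pi>' 0 = (if e then int i + 1 else - (int i + 1))" by (simp add: \<pi>' c_def)
    fix \<rho> :: "'k state"
    assume "loaded H n w (push_div (f (i, e)) D)
      (Ds(i := Ds i + (if e then D else - push_div (f (i, e)) D))) \<rho>"
    \<comment> \<open>The update of \<open>Ds\<close> at \<open>i\<close> is the first summand in
      the recursion of \<open>fox\<close>.\<close>
    from Cons.IH[OF w this] show "runs ent (fox_prog n) \<rho>
      (\<lambda>\<rho>. output_divisors H n \<rho> (\<lambda>j. Ds j + fox (\<lambda>l. push_div (f l)) (l # w) D j))"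
      by (rule back_subst[of "runs ent (fox_prog n) \<rho>"])
        (auto simp: l fun_eq_iff intro!: arg_cong[where f = "output_divisors H n _"])
  qed
  then show ?case
    unfolding fox_prog_def by (subst runs_Loop) (simp add: st \<pi>'_def)
qed

theorem theorem4p2:
  fixes p D\<^sub>B M n :: nat
    and a b :: rat
    and R\<^sub>0 :: "(rat^4) set"
    and K :: "real set"
    and \<sigma> :: "real \<Rightarrow> 'k::field_char_0"
    and nrm :: "'k \<Rightarrow> real"
    and \<iota> :: "'k^4 \<Rightarrow> 'k^2^2"
    and x :: "nat \<Rightarrow> rat^4"
    and rels :: "word set"
  defines "\<Gamma> \<equiv> norm_one_group a b p R\<^sub>0"
    and "H \<equiv> Hp nrm"
  assumes "prime p"
    and "D\<^sub>B > 1" and "squarefree D\<^sub>B" and "even (card (prime_factors D\<^sub>B))"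
    and "M \<ge> 1" and "coprime D\<^sub>B M" and "\<not> p dvd D\<^sub>B * M"
    and "a \<noteq> 0" and "b \<noteq> 0" and "quat_discriminant a b = D\<^sub>B"
    and "eichler_order a b M R\<^sub>0"
    and "real_quadratic_field K" and "inert p K"
    and "completion_at K p nrm \<sigma>"
    and "splitting nrm a b \<iota>"
    and "finite_presentation \<Gamma> n x rels"
  shows "\<exists>P. \<forall>g\<in>carrier \<Gamma>. \<forall>w\<in>words n. \<forall>D\<in>Div H. \<forall>cs \<tau>s.
           g = word_val \<Gamma> x w \<and> represents H cs \<tau>s D \<longrightarrow>
           (\<exists>\<rho> Ds. exec (generator_matrices \<iota> n x) P (input_state w cs \<tau>s) \<rho> \<and>
              output_divisors H n \<rho> Ds \<and>
              (\<forall>i<n. Ds i \<in> Div H) \<and>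
              Poly_Mapping.single g D - (\<Sum>i<n. Poly_Mapping.single (x i) (Ds i))
                \<in> B1 \<Gamma> (div_act \<iota>) (Div H) \<and>
              (\<forall>i<n. deg (Ds i) = exponent_sum i w * deg D))"
proof -
  from \<open>completion_at K p nrm \<sigma>\<close> interpret nonarchimedean_abs nrm
    by unfold_locales (auto simp: completion_at_def)
  note pres = \<open>finite_presentation \<Gamma> n x rels\<close> and spl = \<open>splitting nrm a b \<iota>\<close>
  have \<Gamma>: "mult \<Gamma> = qmul a b" "one \<Gamma> = qone"
    by (simp_all add: \<Gamma>_def norm_one_group_def)
  interpret group \<Gamma>
    by (rule group_of_presentation[OF pres]) (simp_all add: \<Gamma> qmul_assoc qmul_qone)
  have x: "x i \<in> carrier \<Gamma>" if "i < n" for i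
    using pres that by (simp add: finite_presentation_def)
  have iota_mult: "iota_rat \<iota> (g \<otimes>\<^bsub>\<Gamma>\<^esub> h) = iota_rat \<iota> g ** iota_rat \<iota> h" for g h
    by (simp add: \<Gamma> iota_rat_mult[OF spl])
  have inv: "iota_rat \<iota> (inv\<^bsub>\<Gamma>\<^esub> g) ** iota_rat \<iota> g = mat 1" if "g \<in> carrier \<Gamma>" for g
    using that by (simp flip: iota_mult add: \<Gamma>(2) iota_rat_one[OF spl])
  note H = moebius_Hp[OF iota_rat_Qp[OF spl] iota_rat_Qp[OF spl] inv, folded H_def]
  interpret group_module \<Gamma> "div_act \<iota>" "Div H"
  proof
    show "div_act \<iota> g D \<in> Div H" if "g \<in> carrier \<Gamma>" "D \<in> Div H" for g D
      using that H(2) by (auto simp: div_act_def intro: push_div_in_Div)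
    show "div_act \<iota> \<one>\<^bsub>\<Gamma>\<^esub> D = D" for D
      by (simp add: div_act_def \<Gamma> iota_rat_one[OF spl] moebius_one push_div_ident)
    \<comment> \<open>Composition is compared only on the support of \<open>D\<close>, where the
      denominator for \<open>h\<close> does not vanish.\<close>
    show "div_act \<iota> (g \<otimes>\<^bsub>\<Gamma>\<^esub> h) D = div_act \<iota> g (div_act \<iota> h D)"
      if "g \<in> carrier \<Gamma>" "h \<in> carrier \<Gamma>" "D \<in> Div H" for g h D
      unfolding div_act_def push_div_push_div
      by (rule push_div_cong) (use that H(1) in \<open>auto simp: Div_def iota_mult moebius_mult\<close>)
  qed (auto simp: div_act_def push_div_add intro: Div_add Div_uminus)
  define f where "f = (\<lambda>(i, e). moebius (iota_rat \<iota> (if e then inv\<^bsub>\<Gamma>\<^esub> (x i) else x i)))"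
  let ?ent = "generator_matrices \<iota> n x" and ?T = "\<lambda>l. push_div (f l)"
  have expr: "keval ?ent \<pi> (denominator i e) \<noteq> 0 \<and>
      keval ?ent \<pi> (numerator i e) / keval ?ent \<pi> (denominator i e) = f (i, e) (kvar \<pi> 0)"
    if i: "i < n" and "kvar \<pi> 0 \<in> H" for i e \<pi>
  proof (cases e)
    case True
    \<comment> \<open>The upper left entry of the matrix identity for \<open>inv\<close> shows that
      the first column of the generator's matrix is nonzero, so the adjugate has a nonzero lower
      row.\<close>
    have "iota_rat \<iota> (x i) $ 1 $ 1 - iota_rat \<iota> (x i) $ 2 $ 1 * kvar \<pi> 0 \<noteq> 0"
      using Hp_denominator_nonzero[of "- iota_rat \<iota> (x i) $ 2 $ 1" "iota_rat \<iota> (x i) $ 1 $ 1"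
        "kvar \<pi> 0"] that mat2_mult[of "iota_rat \<iota> (inv\<^bsub>\<Gamma>\<^esub> (x i))" "iota_rat \<iota> (x i)" 1 1]
      by (force simp: inv[OF x[OF i]] mat_def H_def iota_rat_Qp[OF spl] Qp_uminus)
    then show ?thesis
      using True i moebius_left_inverse[OF inv[OF x[OF i]]]
      by (simp add: f_def numerator_def denominator_def generator_matrices_def)
  next
    case False
    then show ?thesis
      using that H(1)[OF x[OF i]]
      by (simp add: f_def numerator_def denominator_def generator_matrices_def moebius_def)
  qed
  have fH: "f (i, e) \<tau> \<in> H" if "i < n" "\<tau> \<in> H" for i e \<tau>
    using that H(2) x by (auto simp: f_def)
  have T: "?T = (\<lambda>(i, e). div_act \<iota> (if e then inv\<^bsub>\<Gamma>\<^esub> (x i) else x i))"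
    by (auto simp: f_def div_act_def)
  show ?thesis
  \<comment> \<open>The program is built from \<open>n\<close> alone, so it serves all words and
    divisors.\<close>
  proof (intro exI[of _ "fox_prog n"] ballI allI impI)
    fix g w D cs \<tau>s
    assume w: "w \<in> words n" and D: "D \<in> Div H"
      and g: "g = word_val \<Gamma> x w \<and> represents H cs \<tau>s D"
    \<comment> \<open>The output stacks and the scratch stack start empty, and empty stacks
      represent the divisor 0.\<close>
    have "loaded H n w D (\<lambda>_. 0) (input_state w cs \<tau>s)"
      using g by (auto simp: loaded_def input_state_def output_divisors_def represents_def)
    from runs_fox_prog[OF expr fH w this]
    obtain \<rho> where \<rho>: "exec ?ent (fox_prog n) (input_state w cs \<tau>s) \<rho>"
      "output_divisors H n \<rho> (fox ?T w D)"
      by (auto simp: runs_def)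
    show "\<exists>\<rho> Ds. exec ?ent (fox_prog n) (input_state w cs \<tau>s) \<rho> \<and> output_divisors H n \<rho> Ds \<and>
        (\<forall>i<n. Ds i \<in> Div H) \<and>
        Poly_Mapping.single g D - (\<Sum>i<n. Poly_Mapping.single (x i) (Ds i))
          \<in> B1 \<Gamma> (div_act \<iota>) (Div H) \<and>
        (\<forall>i<n. deg (Ds i) = exponent_sum i w * deg D)"
    proof (intro exI conjI)
      \<comment> \<open>Membership is read off from the output, since a represented divisor is
        supported in \<open>H\<close>.\<close>
      show "\<forall>i<n. fox ?T w D i \<in> Div H"
        using \<rho>(2) by (auto simp: output_divisors_def dest: represents_in_Div)
      show "Poly_Mapping.single g D - (\<Sum>i<n. Poly_Mapping.single (x i) (fox ?T w D i))
          \<in> B1 \<Gamma> (div_act \<iota>) (Div H)"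
        using single_eq_sum_fox_mod_B1[OF x w D] g unfolding T by simp
      show "\<forall>i<n. deg (fox ?T w D i) = exponent_sum i w * deg D"
        by (simp add: deg_fox)
    qed (use \<rho> in auto)
  qed
qed

end
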